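(* Under the standing assumptions A1--A4 (see context), let $\bar u\in\operatorname{dom}g$ and suppose that $\bar u$ satisfies the Polyak--Łojasiewicz--Kurdyka property with $X=Y$ and constants $R,\lambda,\eta>0$, i.e. $$J(u)-J(\bar u)\le\frac\lambda2\inf\{\|\nabla f(u)+\xi\|_Y^2\mid\xi\in\partial g(u)\cap Y\}\qquad\forall u\in B_R(\bar u)\text{ with }J(u)\le J(\bar u)+\eta.$$ Assume further that $\bar u$ is a strict minimizer of $J$ on $B_R(\bar u)$ and that there exist $\mu>0$ and $\bar R\in(0,R)$ with $$\mu\le J(u)-J(\bar u)\qquad\forall u\in\partial B_{\bar R}(\bar u).$$ Then quadratic growth holds with radius $\bar R$, $\theta=\min\{\eta/\bar R^2,\ \mu/\bar R^2,\ 1/\lambda\}$ and with $\infty$ in place of $\eta$, i.e. $$\frac\theta2\|u-\bar u\|_{\mathcal U}^2\le J(u)-J(\bar u)\qquad\forall u\in B_{\bar R}(\bar u).$$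
   Context: Standing assumptions. (A1) $\mathcal U\cong Y^*$, where $Y$ is a separable Banach space with norm $\|\cdot\|_Y$; $\langle\cdot,\cdot\rangle$ is the pairing between $Y$ and $\mathcal U$, and $\mathcal U$ carries the dual norm $\|u\|_{\mathcal U}=\sup_{\|y\|_Y\le1}\langle y,u\rangle$. (A2) $g:\mathcal U\to[0,\infty]$ is proper, convex and sequentially weak* lower semicontinuous. (A3) $f:\mathcal U\to[0,\infty)$ is sequentially weak* lower semicontinuous on $\operatorname{dom}g$, and there are a neighborhood $\mathcal N$ of $\operatorname{dom}g$ in $\mathcal U$ and a map $\nabla f:\operatorname{dom}g\to Y$ such that $f$ is Gâteaux differentiable on $\mathcal N$ with $f'(u)(\delta u)=\langle\nabla f(u),\delta u\rangle$ for all $u\in\operatorname{dom}g$, $\delta u\in\mathcal U$; moreover there is $L_{\nabla f}\ge0$ with $\|\nabla f(u_1)-\nabla f(u_2)\|_Y\le L_{\nabla f}\|u_1-u_2\|_{\mathcal U}$ for all $u_1,u_2\in\operatorname{dom}g$. (A4) With $J:=f+g$: if $\|u_k\|_{\mathcal U}\to\infty$ then $J(u_k)\to\infty$. $Y$ is regarded as a subspace of $\mathcal U^*=Y^{**}$ via the canonical isometric embedding; $\partial g(u)\subset\mathcal U^*$ is the convex subdifferential. $B_r(\bar u)$ is the closed ball of radius $r$ around $\bar u$ in $\mathcal U$ and $\partial B_r(\bar u)$ its boundary (the sphere $\|u-\bar u\|_{\mathcal U}=r$). The infimum over the empty set is $+\infty$. "Strict minimizer on $B_R(\bar u)$" means $J(u)>J(\bar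 u)$ for all $u\in B_R(\bar u)\setminus\{\bar u\}$. *)

theory Defs
  imports "HOL-Analysis.Analysis"
begin

text \<open>
  The dual space of a normed space \<open>'y\<close> is \<open>'y \<Rightarrow>\<^sub>L real\<close> with the operator norm;
  the pairing of \<open>y\<close> and \<open>u\<close> is \<open>blinfun_apply u y\<close>.
  Functions with values in \<open>(-\<infinity>,\<infinity>]\<close> are modelled by type \<open>ereal\<close>.
\<close>

definition effective_domain :: "('a \<Rightarrow> ereal) \<Rightarrow> 'a set" where
  "effective_domain g = {u. g u < \<infinity>}"

definition proper_fun :: "('a \<Rightarrow> ereal) \<Rightarrow> bool" where
  "proper_fun g \<longleftrightarrow> (\<forall>u. g u \<noteq> -\<infinity>) \<and> effective_domain g \<noteq> {}"

text \<open>Meant for functions that never take the value \<open>-\<infinity>\<close>; note \<open>0 * \<infinity> = 0\<close> in \<open>ereal\<close>.\<close>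

definition convex_fun :: "('a::real_vector \<Rightarrow> ereal) \<Rightarrow> bool" where
  "convex_fun g \<longleftrightarrow>
     (\<forall>u v. \<forall>s\<ge>0. \<forall>t\<ge>0. s + t = 1 \<longrightarrow>
        g (s *\<^sub>R u + t *\<^sub>R v) \<le> ereal s * g u + ereal t * g v)"

definition weak_star_tendsto ::
    "(nat \<Rightarrow> 'y::real_normed_vector \<Rightarrow>\<^sub>L real) \<Rightarrow> ('y \<Rightarrow>\<^sub>L real) \<Rightarrow> bool" where
  "weak_star_tendsto w u \<longleftrightarrow> (\<forall>y. (\<lambda>k. blinfun_apply (w k) y) \<longlonglongrightarrow> blinfun_apply u y)"

definition seq_weak_star_lsc_on ::
    "('y::real_normed_vector \<Rightarrow>\<^sub>L real) set \<Rightarrow> (('y \<Rightarrow>\<^sub>L real) \<Rightarrow> ereal) \<Rightarrow> bool" where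
  "seq_weak_star_lsc_on S F \<longleftrightarrow>
     (\<forall>u\<in>S. \<forall>w. (\<forall>k. w k \<in> S) \<longrightarrow> weak_star_tendsto w u \<longrightarrow> F u \<le> liminf (\<lambda>k. F (w k)))"

definition has_gateaux_derivative ::
    "('a::real_normed_vector \<Rightarrow> real) \<Rightarrow> ('a \<Rightarrow>\<^sub>L real) \<Rightarrow> 'a \<Rightarrow> bool" where
  "has_gateaux_derivative f D u \<longleftrightarrow>
     (\<forall>h. ((\<lambda>t. f (u + t *\<^sub>R h)) has_real_derivative blinfun_apply D h) (at 0))"

definition gateaux_differentiable_on :: "('a::real_normed_vector \<Rightarrow> real) \<Rightarrow> 'a set \<Rightarrow> bool" where
  "gateaux_differentiable_on f N \<longleftrightarrow> (\<forall>u\<in>N. \<exists>D. has_gateaux_derivative f D u)"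

text \<open>The canonical embedding of a normed space into its bidual.\<close>

definition bidual_embed :: "'y::real_normed_vector \<Rightarrow> (('y \<Rightarrow>\<^sub>L real) \<Rightarrow>\<^sub>L real)" where
  "bidual_embed y = blinfun.prod_left y"

lemma bidual_embed_apply: "blinfun_apply (bidual_embed y) u = blinfun_apply u y"
  by (simp add: bidual_embed_def)

definition subdifferential ::
    "('a::real_normed_vector \<Rightarrow> ereal) \<Rightarrow> 'a \<Rightarrow> ('a \<Rightarrow>\<^sub>L real) set" where
  "subdifferential g u =
     {\<xi>. u \<in> effective_domain g \<and> (\<forall>v. g u + ereal (blinfun_apply \<xi> (v - u)) \<le> g v)}"

definition objective :: "('a \<Rightarrow> real) \<Rightarrow> ('a \<Rightarrow> ereal) \<Rightarrow> 'a \<Rightarrow> ereal" where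
  "objective f g u = ereal (f u) + g u"

definition coercive_fun :: "('a::real_normed_vector \<Rightarrow> ereal) \<Rightarrow> bool" where
  "coercive_fun F \<longleftrightarrow>
     (\<forall>w. filterlim (\<lambda>k::nat. norm (w k)) at_top sequentially \<longrightarrow> (\<lambda>k. F (w k)) \<longlonglongrightarrow> \<infinity>)"

text \<open>
  The set \<open>\<partial>g(u) \<inter> Y\<close> consists of those \<open>\<xi> :: 'y\<close> whose image in the bidual is a subgradient.
  If there are none, the infimum is \<open>\<infinity>\<close> and, since \<open>lam > 0\<close>, so is the right-hand side.
\<close>

definition plk_property ::
    "(('y::real_normed_vector \<Rightarrow>\<^sub>L real) \<Rightarrow> real) \<Rightarrow> (('y \<Rightarrow>\<^sub>L real) \<Rightarrow> 'y) \<Rightarrow>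
     (('y \<Rightarrow>\<^sub>L real) \<Rightarrow> ereal) \<Rightarrow> ('y \<Rightarrow>\<^sub>L real) \<Rightarrow> real \<Rightarrow> real \<Rightarrow> real \<Rightarrow> bool" where
  "plk_property f grad_f g ubar R lam \<eta> \<longleftrightarrow>
     (\<forall>u\<in>cball ubar R. objective f g u \<le> objective f g ubar + ereal \<eta> \<longrightarrow>
        objective f g u - objective f g ubar
          \<le> ereal (lam / 2) *
             (INF \<xi>\<in>{\<xi>. bidual_embed \<xi> \<in> subdifferential g u}. ereal ((norm (grad_f u + \<xi>))\<^sup>2)))"

definition strict_minimizer_on :: "('a \<Rightarrow> ereal) \<Rightarrow> 'a \<Rightarrow> 'a set \<Rightarrow> bool" where
  "strict_minimizer_on F ubar S \<longleftrightarrow> (\<forall>u\<in>S - {ubar}. F u > F ubar)"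

end

theory Submission
  imports Defs "HOL-Complex_Analysis.Great_Picard"
begin

text \<open>
  Write \<open>d = J - J ubar\<close>. The PLK inequality says that the slope of \<open>sqrt d\<close> is at least
  \<open>1 / sqrt (2 * lam)\<close> away from \<open>ubar\<close>, so that \<open>sqrt d\<close> should dominate that multiple of the
  distance to \<open>ubar\<close>. The usual way to make this precise is a variational principle that perturbs
  \<open>sqrt d\<close> by a multiple of the dual norm. Here this would not suffice: the perturbation would
  produce a subgradient in the bidual, whereas the PLK inequality only speaks about subgradients
  in the predual.

  A linear perturbation by an element of the predual avoids this. If quadratic growth fails at \<open>u\<close>,
  then \<open>sqrt (d u) < sqrt (\<theta> / 2) * norm (u - ubar)\<close>, and by the definition of the dual norm there is a
  \<open>y\<close> in the predual with \<open>norm y < sqrt (\<theta> / 2)\<close> and \<open>sqrt (d u) < (u - ubar) y\<close>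
  (\<open>small_vector_with_large_pairing\<close>). Minimize \<open>sqrt (d v) - v y\<close> over the ball of radius \<open>Rbar\<close>.
  A minimizer \<open>v\<close> exists, since balls are sequentially weak* compact and \<open>y\<close> acts weak*
  continuously (\<open>sqrt_tilted_minimizer_exists\<close>). Comparison with \<open>u\<close> gives
  \<open>sqrt (d v) < (v - ubar) y\<close>. This single inequality locates \<open>v\<close>: it forces \<open>v \<noteq> ubar\<close>, hence
  \<open>d v > 0\<close>, and it bounds \<open>d v\<close> by \<open>\<theta> * Rbar\<^sup>2\<close>, hence strictly below \<open>\<eta>\<close> and \<open>\<mu>\<close>. So \<open>v\<close> is off
  the sphere, and PLK applies at \<open>v\<close>. The first-order condition at the interior minimizer \<open>v\<close>
  (\<open>sqrt_tilted_minimizer_subgradient\<close>) is that \<open>\<xi> = 2 * sqrt (d v) * y - \<nabla>f v\<close> is a subgradient of \<open>g\<close>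
  in the predual, and PLK with this \<open>\<xi>\<close> gives
  \<open>d v \<le> 2 * lam * (norm y)\<^sup>2 * d v < lam * \<theta> * d v \<le> d v\<close>, a contradiction.
\<close>

section \<open>Sequential weak* compactness and lower semicontinuity\<close>

text \<open>
  The sequential Banach--Alaoglu theorem for a separable predual. A diagonal subsequence converges
  on a countable dense set; the uniform bound on the functionals extends the convergence to the
  whole space and makes the limit continuous.
\<close>

lemma weak_star_subsequence:
  fixes w :: "nat \<Rightarrow> 'y::real_normed_vector \<Rightarrow>\<^sub>L real"
  assumes sep: "separable_space (euclidean :: 'y topology)"
    and bdd: "\<And>k. norm (w k) \<le> B"
  obtains u r where "strict_mono (r :: nat \<Rightarrow> nat)" "weak_star_tendsto (w \<circ> r) u"
proof -
  obtain C :: "'y set" where C: "countable C" "closure C = UNIV"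
    using sep by (auto simp: separable_space_def)
  have B: "0 \<le> B" using bdd[of 0] norm_ge_zero order_trans by blast
  have le: "\<bar>w k y\<bar> \<le> B * norm y" for k y
    by (metis bdd mult_right_mono norm_blinfun norm_ge_zero order_trans real_norm_def)
  \<comment> \<open>On \<open>C\<close> itself the values are not bounded uniformly; on the normalized vectors they are.\<close>
  have "norm (w k (sgn y)) \<le> B" for k y
    using le[of k "sgn y"] B by (cases "y = 0") (auto simp: norm_sgn)
  then obtain r :: "nat \<Rightarrow> nat"
    where r: "strict_mono r" "\<And>y. y \<in> C \<Longrightarrow> \<exists>l. (\<lambda>k. w (r k) (sgn y)) \<longlonglongrightarrow> l"
    by (rule function_convergent_subsequence[OF C(1), of "\<lambda>k y. w k (sgn y)"]) blast
  have conv_C: "convergent (\<lambda>k. w (r k) c)" if c: "c \<in> C" for c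
  proof -
    obtain l where "(\<lambda>k. w (r k) (sgn c)) \<longlonglongrightarrow> l" using r(2)[OF c] by blast
    then have "(\<lambda>k. norm c * w (r k) (sgn c)) \<longlonglongrightarrow> norm c * l"
      by (intro tendsto_intros)
    moreover have "norm c * w (r k) (sgn c) = w (r k) c" for k
      by (cases "c = 0") (auto simp: sgn_div_norm blinfun.scaleR_right)
    ultimately show ?thesis by (auto simp: convergent_def)
  qed
  have conv: "convergent (\<lambda>k. w (r k) y)" for y
  proof -
    have "Cauchy (\<lambda>k. w (r k) y)"
    proof (rule metric_CauchyI)
      fix e :: real assume e: "0 < e"
      define d where "d = e / (3 * (B + 1))"
      have d: "0 < d" using e B by (simp add: d_def)
      have "y \<in> closure C" using C(2) by simp
      then obtain c where c: "c \<in> C" "dist c y < d"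
        using d unfolding closure_approachable by blast
      have close: "\<bar>w k y - w k c\<bar> < e / 3" for k
      proof -
        have "\<bar>w k y - w k c\<bar> \<le> B * norm (y - c)"
          using le[of k "y - c"] by (simp add: blinfun.diff_right)
        also have "\<dots> \<le> B * d"
          using c(2) B by (intro mult_left_mono) (auto simp: dist_norm norm_minus_commute)
        also have "\<dots> < (B + 1) * d" using d by simp
        also have "\<dots> = e / 3" using B by (simp add: d_def field_simps)
        finally show ?thesis .
      qed
      have "Cauchy (\<lambda>k. w (r k) c)"
        using conv_C[OF c(1)] by (rule convergent_Cauchy)
      then obtain M where M: "\<forall>m\<ge>M. \<forall>n\<ge>M. dist (w (r m) c) (w (r n) c) < e / 3"
        using e unfolding Cauchy_def by (metis divide_pos_pos zero_less_numeral)
      show "\<exists>M. \<forall>m\<ge>M. \<forall>n\<ge>M. dist (w (r m) y) (w (r n) y) < e"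
      proof (intro exI allI impI)
        fix m n assume "M \<le> m" "M \<le> n"
        then have "\<bar>w (r m) c - w (r n) c\<bar> < e / 3" using M by (auto simp: dist_real_def)
        then show "dist (w (r m) y) (w (r n) y) < e"
          using close[of "r m"] close[of "r n"] unfolding dist_real_def by linarith
      qed
    qed
    then show ?thesis by (rule Cauchy_convergent)
  qed
  define L where "L y = lim (\<lambda>k. w (r k) y)" for y
  have L: "(\<lambda>k. w (r k) y) \<longlonglongrightarrow> L y" for y
    unfolding L_def using conv convergent_LIMSEQ_iff by blast
  have "bounded_linear L"
  proof (rule bounded_linear_intro[where K = B])
    show "L (x + y) = L x + L y" for x y
      using tendsto_add[OF L[of x] L[of y]] L[of "x + y"]
      by (intro LIMSEQ_unique[where X = "\<lambda>k. w (r k) (x + y)"])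
         (auto simp: blinfun.add_right)
    show "L (s *\<^sub>R x) = s *\<^sub>R L x" for s x
      using tendsto_scaleR[OF tendsto_const[of s] L[of x]] L[of "s *\<^sub>R x"]
      by (intro LIMSEQ_unique[where X = "\<lambda>k. w (r k) (s *\<^sub>R x)"])
         (auto simp: blinfun.scaleR_right)
    show "norm (L x) \<le> norm x * B" for x
      using tendsto_norm[OF L[of x]] le
      by (intro Lim_bounded[where M = 0]) (auto simp: mult.commute)
  qed
  then have "weak_star_tendsto (w \<circ> r) (Blinfun L)"
    using L by (simp add: weak_star_tendsto_def bounded_linear_Blinfun_apply)
  with r(1) show thesis by (rule that)
qed

lemma weak_star_limit_in_cball:
  assumes lim: "weak_star_tendsto w u" and w: "\<And>k. w k \<in> cball c r"
  shows "u \<in> cball c r"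
proof -
  have r: "0 \<le> r" using w[of 0] zero_le_dist order_trans unfolding mem_cball by blast
  have "norm (u - c) \<le> r"
  proof (rule norm_blinfun_bound[OF r])
    fix y
    have "(\<lambda>k. norm (w k y - c y)) \<longlonglongrightarrow> norm (u y - c y)"
      using lim by (intro tendsto_norm tendsto_diff tendsto_const) (simp add: weak_star_tendsto_def)
    moreover have "norm (w k y - c y) \<le> r * norm y" for k
    proof -
      have "norm ((w k - c) y) \<le> norm (w k - c) * norm y" by (rule norm_blinfun)
      also have "\<dots> \<le> r * norm y"
        using w[of k] by (intro mult_right_mono) (auto simp: dist_norm norm_minus_commute)
      finally show ?thesis by (simp add: blinfun.diff_left)
    qed
    ultimately show "norm ((u - c) y) \<le> r * norm y"
      by (intro Lim_bounded[where M = 0]) (auto simp: blinfun.diff_left)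
  qed
  then show ?thesis by (simp add: dist_norm norm_minus_commute)
qed

text \<open>
  Since \<open>f\<close> is lower semicontinuous only along the domain of \<open>g\<close>, a limit outside that domain has
  to be treated separately; there lower semicontinuity of \<open>g\<close> alone makes the lower limit infinite.
\<close>

lemma objective_weak_star_lsc:
  assumes f_nonneg: "\<And>u. 0 \<le> f u" and g_nonneg: "\<And>u. 0 \<le> g u"
    and f_lsc: "seq_weak_star_lsc_on (effective_domain g) (\<lambda>u. ereal (f u))"
    and g_lsc: "seq_weak_star_lsc_on UNIV g"
    and w: "\<And>k. w k \<in> effective_domain g" "weak_star_tendsto w u"
  shows "objective f g u \<le> liminf (\<lambda>k. objective f g (w k))"
proof -
  have g_le: "g u \<le> liminf (\<lambda>k. g (w k))"
    using g_lsc w(2) by (auto simp: seq_weak_star_lsc_on_def)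
  show ?thesis
  proof (cases "u \<in> effective_domain g")
    case True
    then have f_le: "ereal (f u) \<le> liminf (\<lambda>k. ereal (f (w k)))"
      using f_lsc w by (auto simp: seq_weak_star_lsc_on_def)
    have "liminf (\<lambda>k. ereal (f (w k))) \<noteq> -\<infinity>" "liminf (\<lambda>k. g (w k)) \<noteq> -\<infinity>"
      using f_le g_le g_nonneg[of u] by auto
    then have "liminf (\<lambda>k. ereal (f (w k))) + liminf (\<lambda>k. g (w k))
        \<le> liminf (\<lambda>k. objective f g (w k))"
      unfolding objective_def by (intro ereal_liminf_add_mono) auto
    moreover have "objective f g u \<le> liminf (\<lambda>k. ereal (f (w k))) + liminf (\<lambda>k. g (w k))"
      unfolding objective_def by (intro add_mono f_le g_le)
    ultimately show ?thesis by order
  next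
    case False
    have "g (w k) \<le> objective f g (w k)" for k
      using add_right_mono[of 0 "ereal (f (w k))" "g (w k)"] f_nonneg
      by (simp add: objective_def)
    then have "liminf (\<lambda>k. g (w k)) \<le> liminf (\<lambda>k. objective f g (w k))"
      by (intro Liminf_mono) auto
    then show ?thesis using False g_le by (auto simp: effective_domain_def)
  qed
qed

section \<open>Linear perturbation of the square root\<close>

text \<open>
  The direct method. Along a weak* convergent minimizing sequence \<open>w\<close> the values \<open>w k y\<close> converge,
  and so \<open>d (w k)\<close> converges as well. This is why \<open>lsc\<close> speaks of sequences with convergent values:
  in this form it holds when \<open>K\<close> is the part of a ball on which an extended-valued lower
  semicontinuous function is finite, although such a set need not be weak* closed.
\<close>

lemma sqrt_tilted_minimizer_exists:
  fixes d :: "('y::real_normed_vector \<Rightarrow>\<^sub>L real) \<Rightarrow> real"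
  assumes sep: "separable_space (euclidean :: 'y topology)"
    and K: "bounded K" "K \<noteq> {}"
    and d_nonneg: "\<And>v. v \<in> K \<Longrightarrow> 0 \<le> d v"
    and lsc: "\<And>w v l. \<lbrakk>\<And>k. w k \<in> K; weak_star_tendsto w v; (\<lambda>k. d (w k)) \<longlonglongrightarrow> l\<rbrakk>
                \<Longrightarrow> v \<in> K \<and> d v \<le> l"
  obtains v where "v \<in> K" "\<And>x. x \<in> K \<Longrightarrow> sqrt (d v) - v y \<le> sqrt (d x) - x y"
proof -
  obtain B where B: "\<And>v. v \<in> K \<Longrightarrow> norm v \<le> B"
    using K(1) unfolding bounded_iff by blast
  define h where "h v = sqrt (d v) - v y" for v
  have bdd: "bdd_below (h ` K)"
  proof (rule bdd_belowI2[where m = "- (B * norm y)"])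
    fix v assume v: "v \<in> K"
    have "v y \<le> norm v * norm y" using norm_blinfun[of v y] by simp
    also have "\<dots> \<le> B * norm y" using B[OF v] by (intro mult_right_mono) auto
    finally show "- (B * norm y) \<le> h v"
      using real_sqrt_ge_zero[OF d_nonneg[OF v]] unfolding h_def by linarith
  qed
  define m where "m = Inf (h ` K)"
  have m: "m \<le> h x" if "x \<in> K" for x
    unfolding m_def using bdd that by (intro cInf_lower) auto
  have "\<exists>x\<in>K. h x < m + 1 / real (Suc k)" for k
    using cInf_lessD[of "h ` K" "m + 1 / real (Suc k)"] K(2) by (auto simp: m_def)
  then obtain x where x: "\<And>k. x k \<in> K" "\<And>k. h (x k) < m + 1 / real (Suc k)"
    by metis
  obtain v r where r: "strict_mono r" and v: "weak_star_tendsto (x \<circ> r) v"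
    using weak_star_subsequence[OF sep, of x B] B x(1) by blast
  have "(\<lambda>k. h (x k)) \<longlonglongrightarrow> m"
  proof (rule tendsto_sandwich[where f = "\<lambda>_. m" and h = "\<lambda>k. m + 1 / real (Suc k)"])
    show "(\<lambda>k. m + 1 / real (Suc k)) \<longlonglongrightarrow> m"
      using tendsto_add[OF tendsto_const LIMSEQ_inverse_real_of_nat, of m]
      by (simp add: inverse_eq_divide)
  qed (use m x in \<open>auto intro!: always_eventually less_imp_le\<close>)
  then have "(\<lambda>k. h (x (r k))) \<longlonglongrightarrow> m"
    using LIMSEQ_subseq_LIMSEQ[OF _ r] by (simp add: comp_def)
  \<comment> \<open>Convergence of the perturbed values forces convergence of \<open>d\<close> along the subsequence.\<close>
  then have "(\<lambda>k. h (x (r k)) + x (r k) y) \<longlonglongrightarrow> m + v y"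
    using v by (intro tendsto_add) (auto simp: weak_star_tendsto_def)
  then have s: "(\<lambda>k. sqrt (d (x (r k)))) \<longlonglongrightarrow> m + v y"
    by (simp add: h_def)
  then have "(\<lambda>k. (sqrt (d (x (r k))))\<^sup>2) \<longlonglongrightarrow> (m + v y)\<^sup>2"
    by (rule tendsto_power)
  then have "(\<lambda>k. d ((x \<circ> r) k)) \<longlonglongrightarrow> (m + v y)\<^sup>2"
    using d_nonneg x(1) by simp
  then have vK: "v \<in> K" "d v \<le> (m + v y)\<^sup>2"
    using lsc[OF _ v] x(1) by auto
  have "0 \<le> m + v y"
    using s d_nonneg x(1) by (intro Lim_bounded2[OF s]) auto
  then have "sqrt (d v) \<le> m + v y"
    using vK(2) real_le_lsqrt by blast
  then have "h v \<le> h z" if "z \<in> K" for z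
    using m[OF that] by (simp add: h_def)
  with vK(1) show thesis
    by (intro that) (auto simp: h_def)
qed

lemma small_vector_with_large_pairing:
  fixes z :: "'y::real_normed_vector \<Rightarrow>\<^sub>L real"
  assumes "0 \<le> a" "0 < s" "a < s * norm z"
  obtains y where "norm y < s" "a < z y"
proof -
  have "\<not> norm z \<le> a / s" using assms by (simp add: field_simps)
  then have "\<not> (\<forall>x. norm (z x) \<le> a / s * norm x)"
    using norm_blinfun_bound[of "a / s" z] assms by auto
  then obtain x where x: "a / s * norm x < \<bar>z x\<bar>" by (auto simp: not_le)
  have x0: "x \<noteq> 0" using x by auto
  then have nx: "0 < norm x" by simp
  have "a < s * (\<bar>z x\<bar> / norm x)" using x nx assms(2) by (simp add: field_simps)
  moreover have pos: "0 < \<bar>z x\<bar> / norm x"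
    using calculation assms(1,2) by (metis le_less_trans zero_less_mult_pos)
  ultimately have "a / (\<bar>z x\<bar> / norm x) < s" by (simp only: pos_divide_less_eq)
  \<comment> \<open>\<open>c\<close> will be the norm of the rescaled \<open>x\<close>.\<close>
  then obtain c where c: "a / (\<bar>z x\<bar> / norm x) < c" "c < s" using dense by blast
  have c0: "0 \<le> c"
    using c(1) pos assms(1) by (meson divide_nonneg_pos less_imp_le order_trans)
  have "a < c * (\<bar>z x\<bar> / norm x)" using c(1) pos by (simp only: pos_divide_less_eq)
  define y where "y = (c * sgn (z x) / norm x) *\<^sub>R x"
  have "z y = c * (\<bar>z x\<bar> / norm x)"
    by (simp add: y_def blinfun.scaleR_right abs_sgn mult.commute)
  moreover have "norm y \<le> c"
    using c0 nx by (simp add: y_def abs_mult sgn_if)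
  ultimately show thesis
    using that[of y] c(2) \<open>a < c * (\<bar>z x\<bar> / norm x)\<close> by simp
qed

text \<open>
  Formally \<open>\<nabla> sqrt d = \<nabla>d / (2 * sqrt d)\<close>, so stationarity of \<open>sqrt d - y\<close> at \<open>v\<close> reads
  \<open>2 * sqrt (d v) * y \<in> p + \<partial>g(v)\<close>. To prove it, move from \<open>v\<close> towards an arbitrary \<open>x\<close> in the domain of
  \<open>g\<close>: convexity bounds the difference quotient of \<open>g\<close> by \<open>g x - g v\<close>, that of \<open>f\<close> tends to the
  Gateaux derivative, and minimality bounds the sum of both from below.
\<close>

lemma sqrt_tilted_minimizer_subgradient:
  fixes f :: "('y::real_normed_vector \<Rightarrow>\<^sub>L real) \<Rightarrow> real"
  assumes g_nonneg: "\<And>u. 0 \<le> g u" and g_convex: "convex_fun g"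
    and grad: "has_gateaux_derivative f (bidual_embed p) v"
    and v: "v \<in> effective_domain g" "v \<in> interior S"
    and nonneg: "\<And>x. x \<in> S \<inter> effective_domain g \<Longrightarrow> 0 \<le> f x + real_of_ereal (g x) - c"
    and min: "\<And>x. x \<in> S \<inter> effective_domain g \<Longrightarrow>
      sqrt (f v + real_of_ereal (g v) - c) - v y \<le> sqrt (f x + real_of_ereal (g x) - c) - x y"
  shows "bidual_embed ((2 * sqrt (f v + real_of_ereal (g v) - c)) *\<^sub>R y - p) \<in> subdifferential g v"
proof -
  define G where "G x = real_of_ereal (g x)" for x
  define d where "d x = f x + G x - c" for x
  have G: "g x = ereal (G x)" if "x \<in> effective_domain g" for x
    using that g_nonneg[of x] unfolding G_def effective_domain_def by (cases "g x") auto
  have v_S: "v \<in> S" using v(2) interior_subset by blast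
  let ?q = "sqrt (d v)"
  have ineq: "G v + (2 * ?q * (x - v) y - (x - v) p) \<le> G x" if x: "x \<in> effective_domain g" for x
  proof -
    define D where "D t = (f (v + t *\<^sub>R (x - v)) - f v) / t" for t
    have "((\<lambda>t. f (v + t *\<^sub>R (x - v))) has_real_derivative (x - v) p) (at 0)"
      using grad unfolding has_gateaux_derivative_def bidual_embed_apply by blast
    then have "(D \<longlongrightarrow> (x - v) p) (at 0)"
      unfolding DERIV_def D_def by simp
    then have lim: "(D \<longlongrightarrow> (x - v) p) (at_right 0)"
      by (rule filterlim_mono) (auto simp: at_le)
    have "((\<lambda>t. v + t *\<^sub>R (x - v)) \<longlongrightarrow> v + 0 *\<^sub>R (x - v)) (at_right 0)"
      by (intro tendsto_intros)
    then have "\<forall>\<^sub>F t in at_right 0. v + t *\<^sub>R (x - v) \<in> interior S"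
      using v(2) by (intro topological_tendstoD) auto
    moreover have "\<forall>\<^sub>F t in at_right (0::real). 0 < t \<and> t < 1"
      using eventually_at_right_less[of 0] eventually_at_right_real[of 0 1]
      by (auto elim: eventually_mono)
    ultimately have "\<forall>\<^sub>F t in at_right 0. 2 * ?q * (x - v) y - (G x - G v) \<le> D t"
    proof eventually_elim
      case (elim t)
      define z where "z = v + t *\<^sub>R (x - v)"
      have z_eq: "z = (1 - t) *\<^sub>R v + t *\<^sub>R x" by (simp add: z_def algebra_simps)
      have "g z \<le> ereal (1 - t) * g v + ereal t * g x"
        using g_convex elim(2) unfolding convex_fun_def z_eq by (smt (verit))
      then have gz: "g z \<le> ereal ((1 - t) * G v + t * G x)" using G x v(1) by simp
      then have z_dom: "z \<in> effective_domain g"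
        by (auto simp: effective_domain_def)
      have Gz: "G z \<le> (1 - t) * G v + t * G x" using gz G[OF z_dom] by simp
      have z_S: "z \<in> S" using elim(1) interior_subset unfolding z_def by blast
      have "?q - v y \<le> sqrt (d z) - z y"
        using min[of z] z_S z_dom by (simp add: d_def G_def)
      moreover have "z y = v y + t * (x - v) y"
        by (simp add: z_def blinfun.add_left blinfun.scaleR_left)
      ultimately have step: "?q + t * (x - v) y \<le> sqrt (d z)" by simp
      have sq: "(sqrt (d z))\<^sup>2 = d z" "?q\<^sup>2 = d v"
        using nonneg[of z] nonneg[of v] z_S z_dom v_S v(1) by (simp_all add: d_def G_def)
      have q0: "0 \<le> ?q" using sq(2) nonneg[of v] v_S v(1) by (simp add: d_def G_def)
      \<comment> \<open>The left-hand side of \<open>step\<close> may be negative, so \<open>step\<close> cannot be squared;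
        the tangent line of the square at \<open>?q\<close> bounds \<open>d z\<close> instead.\<close>
      have "2 * ?q * sqrt (d z) - ?q\<^sup>2 \<le> (sqrt (d z))\<^sup>2"
        using zero_le_power2[of "sqrt (d z) - ?q"] unfolding power2_diff by (simp add: mult.commute mult.left_commute)
      moreover have "2 * ?q * (?q + t * (x - v) y) \<le> 2 * ?q * sqrt (d z)"
        using step q0 by (intro mult_left_mono) auto
      moreover have "2 * ?q * (?q + t * (x - v) y) = 2 * ?q\<^sup>2 + 2 * ?q * (t * (x - v) y)"
        by (simp add: power2_eq_square algebra_simps)
      ultimately have "d v + 2 * ?q * (t * (x - v) y) \<le> d z" using sq by linarith
      then have "t * (2 * ?q * (x - v) y - (G x - G v)) \<le> f z - f v"
        using Gz by (simp add: d_def algebra_simps)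
      then show ?case
        using elim(2) by (simp add: D_def z_def[symmetric] pos_le_divide_eq mult.commute)
    qed
    then have "2 * ?q * (x - v) y - (G x - G v) \<le> (x - v) p"
      by (intro tendsto_lowerbound[OF lim]) auto
    then show ?thesis by simp
  qed
  have "g v + ereal ((x - v) ((2 * ?q) *\<^sub>R y - p)) \<le> g x" for x
  proof (cases "x \<in> effective_domain g")
    case True
    then show ?thesis using ineq[OF True] G v(1)
      by (simp add: blinfun.diff_right blinfun.scaleR_right)
  next
    case False
    then show ?thesis by (simp add: effective_domain_def)
  qed
  then show ?thesis
    using v(1) by (simp add: subdifferential_def bidual_embed_apply d_def G_def)
qed

section \<open>Quadratic growth\<close>

theorem lemma6p7:
  fixes f :: "('y::banach \<Rightarrow>\<^sub>L real) \<Rightarrow> real"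
    and g :: "('y \<Rightarrow>\<^sub>L real) \<Rightarrow> ereal"
    and grad_f :: "('y \<Rightarrow>\<^sub>L real) \<Rightarrow> 'y"
    and ubar :: "'y \<Rightarrow>\<^sub>L real"
    and R Rbar lam \<eta> \<mu> :: real
  assumes Y_separable: "separable_space (euclidean :: 'y topology)"
    and g_nonneg: "\<And>u. 0 \<le> g u"
    and g_proper: "proper_fun g"
    and g_convex: "convex_fun g"
    and g_lsc: "seq_weak_star_lsc_on UNIV g"
    and f_nonneg: "\<And>u. 0 \<le> f u"
    and f_lsc: "seq_weak_star_lsc_on (effective_domain g) (\<lambda>u. ereal (f u))"
    and f_differentiable:
      "\<exists>N. effective_domain g \<subseteq> interior N \<and> gateaux_differentiable_on f N"
    and f_gradient:
      "\<And>u. u \<in> effective_domain g \<Longrightarrow> has_gateaux_derivative f (bidual_embed (grad_f u)) u"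
    and f_gradient_lipschitz:
      "\<exists>L\<ge>0. \<forall>u1\<in>effective_domain g. \<forall>u2\<in>effective_domain g.
         norm (grad_f u1 - grad_f u2) \<le> L * norm (u1 - u2)"
    and J_coercive: "coercive_fun (objective f g)"
    and ubar_dom: "ubar \<in> effective_domain g"
    and pos: "R > 0" "lam > 0" "\<eta> > 0" "\<mu> > 0"
    and plk: "plk_property f grad_f g ubar R lam \<eta>"
    and strict_min: "strict_minimizer_on (objective f g) ubar (cball ubar R)"
    and Rbar: "0 < Rbar" "Rbar < R"
    and sphere_gap:
      "\<And>u. u \<in> sphere ubar Rbar \<Longrightarrow> ereal \<mu> \<le> objective f g u - objective f g ubar"
  shows "\<forall>u\<in>cball ubar Rbar.
    ereal (Min {\<eta> / Rbar\<^sup>2, \<mu> / Rbar\<^sup>2, 1 / lam} / 2 * (norm (u - ubar))\<^sup>2)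
      \<le> objective f g u - objective f g ubar"
proof (rule ballI, rule ccontr)
  define G where "G x = real_of_ereal (g x)" for x
  define c where "c = f ubar + G ubar"
  define d where "d x = f x + G x - c" for x
  have G: "g x = ereal (G x)" if "x \<in> effective_domain g" for x
    using that g_nonneg[of x] unfolding G_def effective_domain_def by (cases "g x") auto
  have J_ubar: "objective f g ubar = ereal c"
    using G[OF ubar_dom] by (simp add: objective_def c_def)
  have J: "objective f g x = ereal (c + d x)" if "x \<in> effective_domain g" for x
    using G[OF that] by (simp add: objective_def d_def)
  have d_ubar: "d ubar = 0" by (simp add: d_def c_def)
  have d_pos: "0 < d x" if "x \<in> cball ubar R" "x \<in> effective_domain g" "x \<noteq> ubar" for x
  proof -
    have "objective f g ubar < objective f g x"
      using strict_min that unfolding strict_minimizer_on_def by blast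
    then show ?thesis using J[OF that(2)] J_ubar by simp
  qed
  define K where "K = cball ubar Rbar \<inter> effective_domain g"
  have ball_sub: "cball ubar Rbar \<subseteq> cball ubar R" using Rbar(2) by auto
  have d_nonneg: "0 \<le> d x" if "x \<in> K" for x
    using d_pos[of x] d_ubar that ball_sub by (cases "x = ubar") (auto simp: K_def)

  define \<theta> where "\<theta> = Min {\<eta> / Rbar\<^sup>2, \<mu> / Rbar\<^sup>2, 1 / lam}"
  have "\<theta> \<le> \<eta> / Rbar\<^sup>2" "\<theta> \<le> \<mu> / Rbar\<^sup>2" "\<theta> \<le> 1 / lam" unfolding \<theta>_def by simp_all
  moreover have "0 < \<theta>" unfolding \<theta>_def using pos Rbar(1) by simp
  ultimately have \<theta>: "0 < \<theta>" "\<theta> * Rbar\<^sup>2 \<le> \<eta>" "\<theta> * Rbar\<^sup>2 \<le> \<mu>" "\<theta> * lam \<le> 1"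
    using pos(2) Rbar(1) by (simp_all add: field_simps)

  fix u assume u: "u \<in> cball ubar Rbar"
    and "\<not> ereal (Min {\<eta> / Rbar\<^sup>2, \<mu> / Rbar\<^sup>2, 1 / lam} / 2 * (norm (u - ubar))\<^sup>2)
      \<le> objective f g u - objective f g ubar"
  then have viol: "objective f g u - ereal c < ereal (\<theta> / 2 * (norm (u - ubar))\<^sup>2)"
    by (simp add: \<theta>_def[symmetric] J_ubar not_le)
  then have "u \<in> effective_domain g"
    by (auto simp: effective_domain_def objective_def)
  then have uK: "u \<in> K" and "d u < \<theta> / 2 * (norm (u - ubar))\<^sup>2"
    using u viol J by (auto simp: K_def)
  then have "sqrt (d u) < sqrt (\<theta> / 2) * norm (u - ubar)"
    by (metis norm_ge_zero real_sqrt_less_iff real_sqrt_mult real_sqrt_unique)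
  then obtain y where y: "norm y < sqrt (\<theta> / 2)" "sqrt (d u) < (u - ubar) y"
    using small_vector_with_large_pairing[of "sqrt (d u)" "sqrt (\<theta> / 2)" "u - ubar"]
      \<theta>(1) d_nonneg[OF uK] by auto
  have y_sq: "(norm y)\<^sup>2 < \<theta> / 2"
    using y(1) \<theta>(1) power_strict_mono[of "norm y" "sqrt (\<theta> / 2)" 2] by simp

  have lsc: "v \<in> K \<and> d v \<le> l"
    if w: "\<And>k. w k \<in> K" "weak_star_tendsto w v" and l: "(\<lambda>k. d (w k)) \<longlonglongrightarrow> l" for w v l
  proof -
    have "(\<lambda>k. ereal (c + d (w k))) \<longlonglongrightarrow> ereal (c + l)" using l by (intro tendsto_intros)
    moreover have "objective f g (w k) = ereal (c + d (w k))" for k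
      using J w(1) by (auto simp: K_def)
    ultimately have "liminf (\<lambda>k. objective f g (w k)) = ereal (c + l)"
      by (simp add: lim_imp_Liminf)
    moreover have "objective f g v \<le> liminf (\<lambda>k. objective f g (w k))"
      using w by (intro objective_weak_star_lsc[OF f_nonneg g_nonneg f_lsc g_lsc]) (auto simp: K_def)
    ultimately have le: "objective f g v \<le> ereal (c + l)" by simp
    then have "v \<in> effective_domain g" by (auto simp: objective_def effective_domain_def)
    moreover have "v \<in> cball ubar Rbar"
      using weak_star_limit_in_cball[OF w(2)] w(1) by (auto simp: K_def)
    ultimately show ?thesis using le J by (auto simp: K_def)
  qed
  have "bounded K" using bounded_cball bounded_subset unfolding K_def by blast
  then obtain v where v: "v \<in> K"
    and v_min: "\<And>x. x \<in> K \<Longrightarrow> sqrt (d v) - v y \<le> sqrt (d x) - x y"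
    using sqrt_tilted_minimizer_exists[OF Y_separable, of K d y] uK d_nonneg lsc by blast
  have v_dom: "v \<in> effective_domain g" and v_ball: "v \<in> cball ubar Rbar"
    using v by (auto simp: K_def)
  have v_slope: "sqrt (d v) < (v - ubar) y"
    using v_min[OF uK] y(2) by (simp add: blinfun.diff_left)
  then have v_ne: "v \<noteq> ubar" using d_ubar by auto
  have dv: "0 < d v" using d_pos v_ball v_dom v_ne ball_sub by blast

  \<comment> \<open>The value at \<open>v\<close> is small enough for \<open>v\<close> to be off the sphere and for PLK to apply at \<open>v\<close>.\<close>
  have "(v - ubar) y \<le> norm (v - ubar) * norm y" using norm_blinfun[of "v - ubar" y] by simp
  also have "\<dots> \<le> Rbar * norm y"
    using v_ball by (intro mult_right_mono) (auto simp: dist_norm norm_minus_commute)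
  finally have "sqrt (d v) < Rbar * norm y" using v_slope by simp
  then have "d v < (Rbar * norm y)\<^sup>2"
    using dv power_strict_mono[of "sqrt (d v)" "Rbar * norm y" 2] by simp
  also have "\<dots> = Rbar\<^sup>2 * (norm y)\<^sup>2" by (simp add: power_mult_distrib)
  also have "\<dots> \<le> Rbar\<^sup>2 * \<theta>" using y_sq \<theta>(1) by (intro mult_left_mono) auto
  finally have dv_small: "d v < \<eta>" "d v < \<mu>" using \<theta>(2,3) by (auto simp: mult.commute)
  have "v \<notin> sphere ubar Rbar"
    using sphere_gap[of v] J[OF v_dom] J_ubar dv_small(2) by auto
  then have v_int: "v \<in> interior (cball ubar Rbar)"
    using v_ball interior_maximal[OF ball_subset_cball open_ball, of ubar Rbar]
    by (auto simp: subset_iff less_le)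

  define \<xi> where "\<xi> = (2 * sqrt (d v)) *\<^sub>R y - grad_f v"
  have \<xi>: "bidual_embed \<xi> \<in> subdifferential g v"
    unfolding \<xi>_def d_def G_def
    by (rule sqrt_tilted_minimizer_subgradient[OF g_nonneg g_convex f_gradient[OF v_dom] v_dom v_int])
       (use d_nonneg v_min in \<open>auto simp: K_def d_def G_def\<close>)
  have "ereal (d v) = objective f g v - objective f g ubar" using J[OF v_dom] J_ubar by simp
  also have "\<dots> \<le> ereal (lam / 2) *
      (INF \<xi>\<in>{\<xi>. bidual_embed \<xi> \<in> subdifferential g v}. ereal ((norm (grad_f v + \<xi>))\<^sup>2))"
  proof -
    have "objective f g v \<le> objective f g ubar + ereal \<eta>"
      using J[OF v_dom] J_ubar dv_small(1) by simp
    moreover have "v \<in> cball ubar R" using v_ball ball_sub by blast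
    ultimately show ?thesis using plk unfolding plk_property_def by blast
  qed
  also have "\<dots> \<le> ereal (lam / 2) * ereal ((norm (grad_f v + \<xi>))\<^sup>2)"
    using \<xi> pos(2) by (intro ereal_mult_left_mono INF_lower) auto
  finally have "d v \<le> lam / 2 * (norm (grad_f v + \<xi>))\<^sup>2" by simp
  also have "\<dots> = d v * (2 * lam * (norm y)\<^sup>2)"
    using dv by (simp add: \<xi>_def power_mult_distrib)
  also have "\<dots> < d v * (\<theta> * lam)"
    using y_sq dv pos(2) by (intro mult_strict_left_mono) auto
  also have "\<dots> \<le> d v" using \<theta>(4) dv by (simp add: mult_left_le)
  finally show False by simp
qed

end
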